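(* Let $f,h,w$ be positive integers, $N=fhw$, let $F\in\mathbb{C}^{N\times N}$ be the three-dimensional DFT matrix of size $(f,h,w)$, and write $F=A+iB$ with $A=\Re(F)$, $B=\Im(F)$. Let $\Lambda$ be a real diagonal $N\times N$ matrix with all diagonal entries in $[0,1]$, and let $\theta\in\mathbb{R}$. Let $x,\eta_1,\eta_2,y_1,y_2$ be mutually independent random vectors in $\mathbb{R}^N$, each distributed as $\mathcal{N}(0,I)$. For $j\in\{1,2\}$ set $$x_j=\frac{1}{\sqrt{1+\cos^2\theta}}\left(\cos\theta\, x+\sin\theta\,\eta_j\right),\qquad z_j=F^{-1}\Lambda F x_j+F^{-1}(I-\Lambda^2)^{1/2}F y_j,$$ and let $$z=\frac{1}{\sqrt2}\left(\Re(z_1)+\Im(z_1)+\Re(z_2)-\Im(z_2)\right).$$ Then $$z\sim\mathcal{N}\left(0,\ I-\frac{2\cos^2\theta}{1+\cos^2\theta}\,Q^2\right),\qquad Q=\frac1N\left(A\Lambda B+B\Lambda A\right).$$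
   Context: The (one-dimensional) DFT matrix of size $n$ is $F_n=\left(\omega_n^{(m-1)(k-1)}\right)_{1\le m,k\le n}$ with $\omega_n=e^{-2\pi i/n}$. The three-dimensional DFT matrix of size $(f,h,w)$ is the Kronecker product $F=F_f\otimes F_h\otimes F_w\in\mathbb{C}^{N\times N}$, $N=fhw$; its inverse is $F^{-1}=\frac1N F^\ast$. $\Re$ and $\Im$ denote entrywise real and imaginary parts. $\mathcal{N}(\mu,\Sigma)$ denotes the (possibly degenerate) Gaussian distribution with mean $\mu$ and covariance matrix $\Sigma$. $(I-\Lambda^2)^{1/2}$ is the diagonal matrix with the entrywise nonnegative square roots on the diagonal. *)

theory Defs
  imports "HOL-Analysis.Analysis" "HOL-Probability.Probability"
begin

(* 0-based position of an index in the linear order of its type, i.e. m - 1 for the m-th index;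
   a bijection onto {..<CARD('n)}. *)
definition pos :: "'n::{finite,linorder} \<Rightarrow> nat" where
  "pos m = card {..<m}"

definition dft_root :: "nat \<Rightarrow> complex" where
  "dft_root n = exp (- 2 * complex_of_real pi * \<i> / of_nat n)"

definition dft_matrix :: "complex ^ 'n::{finite,linorder} ^ 'n::{finite,linorder}" where
  "dft_matrix = (\<chi> m k. dft_root CARD('n) ^ (pos m * pos k))"

(* Rows and columns of a Kronecker product are indexed by pairs; the usual single index is the
   lexicographic position of the pair. *)
definition kronecker :: "'a::times ^ 'n ^ 'm \<Rightarrow> 'a ^ 'q ^ 'p \<Rightarrow> 'a ^ ('n \<times> 'q) ^ ('m \<times> 'p)"
    (infixr "\<otimes>\<^sub>K" 70) where
  "A \<otimes>\<^sub>K B = (\<chi> r c. A $ fst r $ fst c * B $ snd r $ snd c)"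

definition dft3_matrix ::
    "complex ^ ('f::{finite,linorder} \<times> 'h::{finite,linorder} \<times> 'w::{finite,linorder})
             ^ ('f \<times> 'h \<times> 'w)" where
  "dft3_matrix = dft_matrix \<otimes>\<^sub>K dft_matrix \<otimes>\<^sub>K dft_matrix"

definition Re_vec :: "complex ^ 'n \<Rightarrow> real ^ 'n" where
  "Re_vec v = (\<chi> i. Re (v $ i))"

definition Im_vec :: "complex ^ 'n \<Rightarrow> real ^ 'n" where
  "Im_vec v = (\<chi> i. Im (v $ i))"

definition cvec :: "real ^ 'n \<Rightarrow> complex ^ 'n" where
  "cvec v = (\<chi> i. complex_of_real (v $ i))"

definition Re_mat :: "complex ^ 'n ^ 'm \<Rightarrow> real ^ 'n ^ 'm" where
  "Re_mat A = (\<chi> i j. Re (A $ i $ j))"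

definition Im_mat :: "complex ^ 'n ^ 'm \<Rightarrow> real ^ 'n ^ 'm" where
  "Im_mat A = (\<chi> i j. Im (A $ i $ j))"

definition cmat :: "real ^ 'n ^ 'm \<Rightarrow> complex ^ 'n ^ 'm" where
  "cmat A = (\<chi> i j. complex_of_real (A $ i $ j))"

definition diagonal_matrix :: "'a::zero ^ 'n ^ 'n \<Rightarrow> bool" where
  "diagonal_matrix A \<longleftrightarrow> (\<forall>i j. i \<noteq> j \<longrightarrow> A $ i $ j = 0)"

(* Meant for diagonal matrices with nonnegative entries only. *)
definition diag_sqrt :: "real ^ 'n ^ 'n \<Rightarrow> real ^ 'n ^ 'n" where
  "diag_sqrt D = (\<chi> i j. if i = j then sqrt (D $ i $ i) else 0)"

(* Mean m and standard deviation s >= 0; a point mass if s = 0. *)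
definition normal_measure :: "real \<Rightarrow> real \<Rightarrow> real measure" where
  "normal_measure m s = (if s = 0 then return borel m else density lborel (normal_density m s))"

(* X is Gaussian iff all its one-dimensional projections are, and its law is then determined by
   mean and covariance. All moments of a Gaussian vector are finite, so none of the integrals
   below takes the default value 0 of a non-integrable function. *)
definition gaussian_vector ::
    "'s measure \<Rightarrow> ('s \<Rightarrow> real ^ 'n) \<Rightarrow> real ^ 'n \<Rightarrow> real ^ 'n ^ 'n \<Rightarrow> bool" where
  "gaussian_vector M X \<mu> \<Sigma> \<longleftrightarrow>
     X \<in> borel_measurable M \<and>
     (\<forall>t. \<exists>m s. 0 \<le> s \<and> distr M borel (\<lambda>\<omega>. t \<bullet> X \<omega>) = normal_measure m s) \<and>
     (\<forall>i. (\<integral>\<omega>. X \<omega> $ i \<partial>M) = \<mu> $ i) \<and>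
     (\<forall>i j. (\<integral>\<omega>. (X \<omega> $ i - \<mu> $ i) * (X \<omega> $ j - \<mu> $ j) \<partial>M) = \<Sigma> $ i $ j)"

end

(* Write the matrix F^-1 D F, for D real and diagonal, as P + iR with P and R real. As F is
   symmetric, P is symmetric and R antisymmetric, so that z is the sum of real linear images of the
   five independent vectors with the matrices 2P, P + R, P - R (up to scalars) for D = Lambda and
   P + R, P - R for D = (I - Lambda^2)^(1/2). A sum of linear images of independent Gaussian vectors
   is Gaussian, also in the degenerate case, by characteristic functions. The covariance follows
   from two identities: F^-1 Lambda^2 F + F^-1 (I - Lambda^2) F = I, whose real part controls the
   terms P^2 - R^2, and AB = BA = 0, which holds because F F* and F^2 are both real and which turns
   R^2 into -Q^2 for D = Lambda. *)
theory Submission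
  imports Defs
begin

section \<open>Possibly degenerate Gaussian vectors\<close>

text \<open>Point masses and densities become affine images of one law, so characteristic functions
  and moments can be computed without separating the case \<open>s = 0\<close>.\<close>

lemma normal_measure_eq_distr_std:
  assumes "0 \<le> s"
  shows "normal_measure m s = distr std_normal_distribution borel (\<lambda>x. m + s * x)"
proof (cases "s = 0")
  case True
  interpret prob_space std_normal_distribution
    by (intro prob_space_normal_density) simp
  show ?thesis
    using True by (simp add: normal_measure_def distr_const)
next
  case False
  interpret prob_space std_normal_distribution
    by (intro prob_space_normal_density) simp
  have "distributed std_normal_distribution lborel (\<lambda>x. x) std_normal_density"
    by (auto simp: distributed_def distr_id2)
  from normal_density_affine[OF this, of s m]
  have "distributed std_normal_distribution lborel (\<lambda>x. m + s * x) (normal_density m s)"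
    using False assms by simp
  then have "density lborel (normal_density m s) = distr std_normal_distribution lborel (\<lambda>x. m + s * x)"
    by (simp add: distributed_def)
  also have "\<dots> = distr std_normal_distribution borel (\<lambda>x. m + s * x)"
    by (rule distr_cong) auto
  finally show ?thesis
    using False by (simp add: normal_measure_def)
qed

lemma real_distribution_normal_measure:
  assumes "0 \<le> s"
  shows "real_distribution (normal_measure m s)"
proof -
  interpret prob_space std_normal_distribution
    by (intro prob_space_normal_density) simp
  show ?thesis
    unfolding normal_measure_eq_distr_std[OF assms] by (intro real_distribution_distr) simp
qed

lemma char_normal_measure:
  assumes "0 \<le> s"
  shows "char (normal_measure m s) t = iexp (t * m) * complex_of_real (exp (- (s\<^sup>2 * t\<^sup>2) / 2))"
proof -
  have "char (normal_measure m s) t = (CLINT x|std_normal_distribution. iexp (t * (m + s * x)))"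
    unfolding normal_measure_eq_distr_std[OF assms] char_def by (subst integral_distr) auto
  also have "\<dots> = (CLINT x|std_normal_distribution. iexp (t * m) * iexp ((s * t) * x))"
    by (simp add: exp_add[symmetric] algebra_simps)
  also have "\<dots> = iexp (t * m) * char std_normal_distribution (s * t)"
    unfolding char_def by (rule integral_mult_right_zero)
  finally show ?thesis
    by (simp add: char_std_normal_distribution power_mult_distrib)
qed

text \<open>By Levy's uniqueness theorem it suffices to compare characteristic functions.
  Independence makes them multiply, and means and variances add up in the exponent. Degenerate
  summands are included, as projections of Gaussian vectors may be constant.\<close>

lemma (in prob_space) sum_indep_normal_measure:
  assumes indep: "indep_vars (\<lambda>_. borel) X I"
    and X: "\<And>i. i \<in> I \<Longrightarrow> distr M borel (X i) = normal_measure (m i) (s i)"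
    and s: "\<And>i. i \<in> I \<Longrightarrow> 0 \<le> s i"
  shows "distr M borel (\<lambda>\<omega>. \<Sum>i\<in>I. X i \<omega>) = normal_measure (\<Sum>i\<in>I. m i) (sqrt (\<Sum>i\<in>I. (s i)\<^sup>2))"
proof (rule Levy_uniqueness)
  have rv: "i \<in> I \<Longrightarrow> random_variable borel (X i)" for i
    using indep by (auto simp: indep_vars_def)
  show "real_distribution (distr M borel (\<lambda>\<omega>. \<Sum>i\<in>I. X i \<omega>))"
    by (intro real_distribution_distr borel_measurable_sum rv)
  have nonneg: "0 \<le> (\<Sum>i\<in>I. (s i)\<^sup>2)"
    by (intro sum_nonneg) simp
  then show "real_distribution (normal_measure (\<Sum>i\<in>I. m i) (sqrt (\<Sum>i\<in>I. (s i)\<^sup>2)))"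
    by (intro real_distribution_normal_measure) simp
  show "char (distr M borel (\<lambda>\<omega>. \<Sum>i\<in>I. X i \<omega>))
      = char (normal_measure (\<Sum>i\<in>I. m i) (sqrt (\<Sum>i\<in>I. (s i)\<^sup>2)))"
  proof
    fix t
    have "char (distr M borel (\<lambda>\<omega>. \<Sum>i\<in>I. X i \<omega>)) t
        = (\<Prod>i\<in>I. iexp (t * m i) * complex_of_real (exp (- ((s i)\<^sup>2 * t\<^sup>2) / 2)))"
      by (simp add: char_distr_sum[OF indep] X s char_normal_measure)
    also have "\<dots> = (\<Prod>i\<in>I. exp (\<i> * complex_of_real (t * m i) - complex_of_real ((s i)\<^sup>2 * t\<^sup>2 / 2)))"
      by (simp add: exp_of_real[symmetric] exp_add[symmetric])
    also have "\<dots> = exp (\<Sum>i\<in>I. \<i> * complex_of_real (t * m i) - complex_of_real ((s i)\<^sup>2 * t\<^sup>2 / 2))"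
      \<comment> \<open>For infinite \<open>I\<close> the product defaults to 1 and the sum to 0,
        which is consistent with \<open>exp 0 = 1\<close>.\<close>
      by (cases "finite I") (simp_all add: exp_sum)
    also have "\<dots> = exp (\<i> * complex_of_real (t * (\<Sum>i\<in>I. m i)) - complex_of_real ((\<Sum>i\<in>I. (s i)\<^sup>2) * t\<^sup>2 / 2))"
      by (simp add: sum_subtractf sum_distrib_left sum_distrib_right sum_divide_distrib)
    also have "\<dots> = char (normal_measure (\<Sum>i\<in>I. m i) (sqrt (\<Sum>i\<in>I. (s i)\<^sup>2))) t"
      using nonneg by (simp add: char_normal_measure exp_of_real[symmetric] exp_add[symmetric])
    finally show "char (distr M borel (\<lambda>\<omega>. \<Sum>i\<in>I. X i \<omega>)) t
        = char (normal_measure (\<Sum>i\<in>I. m i) (sqrt (\<Sum>i\<in>I. (s i)\<^sup>2))) t" .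
  qed
qed

section \<open>Moments and closure properties of Gaussian vectors\<close>

context prob_space
begin

lemma gaussian_vector_measurable:
  "gaussian_vector M X \<mu> \<Sigma> \<Longrightarrow> X \<in> borel_measurable M"
  by (simp add: gaussian_vector_def)

text \<open>A projection has the law of \<open>m + s * x\<close> with \<open>x\<close> standard
  normal, and the binomial expansion reduces its powers to standard normal moments. The moment
  equations in \<open>gaussian_vector\<close> do not by themselves exclude the default value 0 of an
  integral, so integrability has to come from the projections.\<close>

lemma gaussian_vector_integrable_inner_power:
  assumes "gaussian_vector M X \<mu> \<Sigma>"
  shows "integrable M (\<lambda>\<omega>. (t \<bullet> X \<omega>) ^ k)"
proof -
  have [measurable]: "X \<in> borel_measurable M"
    by (rule gaussian_vector_measurable) fact
  obtain m s where "0 \<le> s" and eq: "distr M borel (\<lambda>\<omega>. t \<bullet> X \<omega>) = normal_measure m s"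
    using assms unfolding gaussian_vector_def by blast
  have "integrable std_normal_distribution (\<lambda>x. (m + s * x) ^ k)"
    unfolding binomial_ring power_mult_distrib
    by (intro Bochner_Integration.integrable_sum integrable_mult_right
        integrable_std_normal_distribution_moment)
  then have "integrable (distr M borel (\<lambda>\<omega>. t \<bullet> X \<omega>)) (\<lambda>x. x ^ k)"
    unfolding eq normal_measure_eq_distr_std[OF \<open>0 \<le> s\<close>] by (subst integrable_distr_eq) auto
  then show ?thesis
    by (subst (asm) integrable_distr_eq) auto
qed

lemma gaussian_vector_integrable:
  assumes "gaussian_vector M X \<mu> \<Sigma>"
  shows "integrable M (\<lambda>\<omega>. X \<omega> $ i)"
  using gaussian_vector_integrable_inner_power[OF assms, of "axis i 1" 1] by (simp add: inner_axis')

lemma gaussian_vector_integrable_mult: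
  assumes "gaussian_vector M X \<mu> \<Sigma>"
  shows "integrable M (\<lambda>\<omega>. X \<omega> $ i * X \<omega> $ j)"
proof -
  \<comment> \<open>Polarization writes the product through squares of projections.\<close>
  have *: "X \<omega> $ i * X \<omega> $ j
      = (((axis i 1 + axis j 1) \<bullet> X \<omega>)\<^sup>2 - (axis i 1 \<bullet> X \<omega>)\<^sup>2 - (axis j 1 \<bullet> X \<omega>)\<^sup>2) / 2" for \<omega>
    by (simp add: inner_axis' inner_add_left power2_eq_square field_simps)
  show ?thesis
    unfolding * by (intro integrable_divide Bochner_Integration.integrable_diff
        gaussian_vector_integrable_inner_power[OF assms])
qed

lemma gaussian_vector_integrable_centred_mult:
  assumes "gaussian_vector M X \<mu> \<Sigma>"
  shows "integrable M (\<lambda>\<omega>. (X \<omega> $ i - \<mu> $ i) * (X \<omega> $ j - \<mu> $ j))"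
  by (simp add: algebra_simps gaussian_vector_integrable[OF assms]
      gaussian_vector_integrable_mult[OF assms])

lemma gaussian_vector_matrix_mult:
  fixes L :: "real ^ 'n ^ 'm"
  assumes X: "gaussian_vector M X \<mu> \<Sigma>"
  shows "gaussian_vector M (\<lambda>\<omega>. L *v X \<omega>) (L *v \<mu>) (L ** \<Sigma> ** transpose L)"
  unfolding gaussian_vector_def
proof (intro conjI allI)
  show "(\<lambda>\<omega>. L *v X \<omega>) \<in> borel_measurable M"
    by (intro measurable_compose[OF gaussian_vector_measurable[OF X]]
        borel_measurable_continuous_onI matrix_vector_mult_linear_continuous_on)
  \<comment> \<open>The projection of the image along \<open>t\<close> is the projection of
    \<open>X\<close> along \<open>t v* L\<close>.\<close>
  show "\<exists>m s. 0 \<le> s \<and> distr M borel (\<lambda>\<omega>. t \<bullet> (L *v X \<omega>)) = normal_measure m s" for t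
    using X unfolding gaussian_vector_def by (simp add: dot_lmul_matrix[symmetric])
  show "(\<integral>\<omega>. (L *v X \<omega>) $ i \<partial>M) = (L *v \<mu>) $ i" for i
    using X gaussian_vector_integrable[OF X]
    by (simp add: matrix_vector_mult_def gaussian_vector_def)
  fix i j
  have centred: "(L *v X \<omega>) $ i - (L *v \<mu>) $ i = (\<Sum>k\<in>UNIV. L $ i $ k * (X \<omega> $ k - \<mu> $ k))" for i \<omega>
    by (simp add: matrix_vector_mult_def sum_subtractf right_diff_distrib)
  have "(\<integral>\<omega>. ((L *v X \<omega>) $ i - (L *v \<mu>) $ i) * ((L *v X \<omega>) $ j - (L *v \<mu>) $ j) \<partial>M)
      = (\<integral>\<omega>. (\<Sum>k\<in>UNIV. \<Sum>l\<in>UNIV. (L $ i $ k * L $ j $ l)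
           * ((X \<omega> $ k - \<mu> $ k) * (X \<omega> $ l - \<mu> $ l))) \<partial>M)"
    unfolding centred sum_product by (simp only: mult_ac)
  also have "\<dots> = (\<Sum>k\<in>UNIV. \<Sum>l\<in>UNIV. (L $ i $ k * L $ j $ l) * \<Sigma> $ k $ l)"
    using X gaussian_vector_integrable_centred_mult[OF X]
    by (simp add: gaussian_vector_def)
  also have "\<dots> = (L ** \<Sigma> ** transpose L) $ i $ j"
    by (subst sum.swap)
      (simp add: matrix_matrix_mult_def transpose_def sum_distrib_left sum_distrib_right mult_ac)
  finally show "(\<integral>\<omega>. ((L *v X \<omega>) $ i - (L *v \<mu>) $ i) * ((L *v X \<omega>) $ j - (L *v \<mu>) $ j) \<partial>M)
      = (L ** \<Sigma> ** transpose L) $ i $ j" .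
qed

text \<open>Projections of the summands are independent normal variables, so their sum is normal. In
  the covariance the terms pairing different summands vanish, because independent centred variables
  are uncorrelated.\<close>

lemma gaussian_vector_sum:
  fixes X :: "'i \<Rightarrow> 'a \<Rightarrow> real ^ 'n"
  assumes fin: "finite I" and indep: "indep_vars (\<lambda>_. borel) X I"
    and X: "\<And>k. k \<in> I \<Longrightarrow> gaussian_vector M (X k) (\<mu> k) (\<Sigma> k)"
  shows "gaussian_vector M (\<lambda>\<omega>. \<Sum>k\<in>I. X k \<omega>) (\<Sum>k\<in>I. \<mu> k) (\<Sum>k\<in>I. \<Sigma> k)"
  unfolding gaussian_vector_def
proof (intro conjI allI)
  show "(\<lambda>\<omega>. \<Sum>k\<in>I. X k \<omega>) \<in> borel_measurable M"
    using X by (intro borel_measurable_sum gaussian_vector_measurable)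
  show "\<exists>m s. 0 \<le> s \<and> distr M borel (\<lambda>\<omega>. t \<bullet> (\<Sum>k\<in>I. X k \<omega>)) = normal_measure m s" for t
  proof -
    have "\<forall>k\<in>I. \<exists>m s. 0 \<le> s \<and> distr M borel (\<lambda>\<omega>. t \<bullet> X k \<omega>) = normal_measure m s"
      using X unfolding gaussian_vector_def by blast
    then obtain m s where ms: "k \<in> I \<Longrightarrow> 0 \<le> s k"
      "k \<in> I \<Longrightarrow> distr M borel (\<lambda>\<omega>. t \<bullet> X k \<omega>) = normal_measure (m k) (s k)" for k
      by metis
    have "indep_vars (\<lambda>_. borel) (\<lambda>k \<omega>. t \<bullet> X k \<omega>) I"
      by (rule indep_vars_compose2[OF indep]) simp
    from sum_indep_normal_measure[OF this ms(2) ms(1)] show ?thesis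
      by (intro exI[of _ "sum m I"] exI[of _ "sqrt (\<Sum>k\<in>I. (s k)\<^sup>2)"])
        (simp add: inner_sum_right sum_nonneg)
  qed
  show "(\<integral>\<omega>. (\<Sum>k\<in>I. X k \<omega>) $ i \<partial>M) = (\<Sum>k\<in>I. \<mu> k) $ i" for i
    using X gaussian_vector_integrable[OF X]
    by (simp add: gaussian_vector_def)
  fix i j
  define Y where "Y k i \<omega> = X k \<omega> $ i - \<mu> k $ i" for k i \<omega>
  have Y0: "(\<integral>\<omega>. Y k i \<omega> \<partial>M) = 0" and Yint: "integrable M (Y k i)" if "k \<in> I" for k i
    unfolding Y_def[abs_def]
    using X[OF that] gaussian_vector_integrable[OF X[OF that], of i]
    by (simp_all add: gaussian_vector_def prob_space)
  have cross: "integrable M (\<lambda>\<omega>. Y k i \<omega> * Y l j \<omega>)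
      \<and> (\<integral>\<omega>. Y k i \<omega> * Y l j \<omega> \<partial>M) = (if k = l then \<Sigma> k $ i $ j else 0)"
    if "k \<in> I" "l \<in> I" for k l
  proof (cases "k = l")
    case True
    then show ?thesis
      using X[OF \<open>k \<in> I\<close>] gaussian_vector_integrable_centred_mult[OF X[OF \<open>k \<in> I\<close>]]
      by (simp add: Y_def gaussian_vector_def)
  next
    case False
    \<comment> \<open>The product rule for expectations needs one independent family:
      \<open>Z\<close> assigns coordinate \<open>i\<close> to index \<open>k\<close> and coordinate
      \<open>j\<close> to index \<open>l\<close>.\<close>
    define Z where "Z r = (if r = k then Y k i else Y l j)" for r
    have "indep_vars (\<lambda>_. borel) (\<lambda>r \<omega>. (\<lambda>v. if r = k then v $ i - \<mu> k $ i else v $ j - \<mu> l $ j) (X r \<omega>)) {k, l}"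
      using that by (intro indep_vars_compose2[OF indep_vars_subset[OF indep]]) auto
    also have "?this \<longleftrightarrow> indep_vars (\<lambda>_. borel) Z {k, l}"
      using False by (intro indep_vars_cong) (auto simp: Z_def Y_def fun_eq_iff)
    finally have ind: "indep_vars (\<lambda>_. borel) Z {k, l}" .
    have Zint: "r \<in> {k, l} \<Longrightarrow> integrable M (Z r)" for r
      using that Yint by (auto simp: Z_def)
    show ?thesis
      using indep_vars_lebesgue_integral[OF _ ind Zint] indep_vars_integrable[OF _ ind Zint]
        False Y0 that
      by (simp add: Z_def)
  qed
  have "(\<integral>\<omega>. ((\<Sum>k\<in>I. X k \<omega>) $ i - (\<Sum>k\<in>I. \<mu> k) $ i) * ((\<Sum>k\<in>I. X k \<omega>) $ j - (\<Sum>k\<in>I. \<mu> k) $ j) \<partial>M)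
      = (\<integral>\<omega>. (\<Sum>k\<in>I. \<Sum>l\<in>I. Y k i \<omega> * Y l j \<omega>) \<partial>M)"
    by (simp add: Y_def sum_subtractf[symmetric] sum_product)
  also have "\<dots> = (\<Sum>k\<in>I. \<Sum>l\<in>I. if k = l then \<Sigma> k $ i $ j else 0)"
    using cross by (simp add: Bochner_Integration.integral_sum)
  also have "\<dots> = (\<Sum>k\<in>I. \<Sigma> k) $ i $ j"
    using fin by simp
  finally show "(\<integral>\<omega>. ((\<Sum>k\<in>I. X k \<omega>) $ i - (\<Sum>k\<in>I. \<mu> k) $ i)
      * ((\<Sum>k\<in>I. X k \<omega>) $ j - (\<Sum>k\<in>I. \<mu> k) $ j) \<partial>M) = (\<Sum>k\<in>I. \<Sigma> k) $ i $ j" .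
qed

end

section \<open>Real and imaginary parts of complex matrices\<close>

lemma matrix_add_rdistrib: "(A + B) ** C = A ** C + B ** C"
  by (vector matrix_matrix_mult_def sum.distrib[symmetric] distrib_right)

lemma matrix_diff_ldistrib:
  fixes A :: "'a::ring_1 ^ 'n ^ 'm"
  shows "A ** (B - C) = A ** B - A ** C"
  by (vector matrix_matrix_mult_def sum_subtractf[symmetric] right_diff_distrib)

lemma matrix_diff_rdistrib:
  fixes A :: "'a::ring_1 ^ 'n ^ 'm"
  shows "(A - B) ** C = A ** C - B ** C"
  by (vector matrix_matrix_mult_def sum_subtractf[symmetric] left_diff_distrib)

lemma matrix_mult_scaleR_left:
  fixes A :: "'a::real_algebra_1 ^ 'n ^ 'm"
  shows "(k *\<^sub>R A) ** B = k *\<^sub>R (A ** B)"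
  by (simp add: scalar_matrix_assoc)

lemma matrix_mult_scaleR_right:
  fixes A :: "'a::real_algebra_1 ^ 'n ^ 'm"
  shows "A ** (k *\<^sub>R B) = k *\<^sub>R (A ** B)"
  by (simp add: matrix_scalar_ac scalar_matrix_assoc)

lemma matrix_mult_minus_left:
  fixes A :: "'a::ring_1 ^ 'n ^ 'm"
  shows "(- A) ** B = - (A ** B)"
  by (vector matrix_matrix_mult_def sum_negf[symmetric])

lemma matrix_mult_minus_right:
  fixes A :: "'a::ring_1 ^ 'n ^ 'm"
  shows "A ** (- B) = - (A ** B)"
  by (vector matrix_matrix_mult_def sum_negf[symmetric])

lemmas matrix_distribs = matrix_add_ldistrib matrix_add_rdistrib matrix_diff_ldistrib
  matrix_diff_rdistrib matrix_mult_scaleR_left matrix_mult_scaleR_right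

lemma transpose_add: "transpose (A + B) = transpose A + transpose B"
  by (vector transpose_def)

lemma transpose_diff: "transpose (A - B) = transpose A - transpose B"
  by (vector transpose_def)

lemma matrix_inv_eqI:
  assumes "A ** B = mat 1" "B ** A = mat 1"
  shows "matrix_inv A = B"
proof -
  \<comment> \<open>\<open>matrix_inv\<close> is a choice among inverses; \<open>B\<close> witnesses
    that there is one.\<close>
  have inv: "A ** matrix_inv A = mat 1"
    unfolding matrix_inv_def by (rule someI2[where a = B]) (use assms in auto)
  have "matrix_inv A = (B ** A) ** matrix_inv A"
    by (simp add: assms)
  also have "\<dots> = B"
    by (simp add: matrix_mul_assoc[symmetric] inv)
  finally show ?thesis .
qed

section \<open>Entrywise real and imaginary parts\<close>

lemma Re_mat_mult: "Re_mat (X ** Y) = Re_mat X ** Re_mat Y - Im_mat X ** Im_mat Y"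
  by (simp add: Re_mat_def Im_mat_def matrix_matrix_mult_def vec_eq_iff sum_subtractf)

lemma Im_mat_mult: "Im_mat (X ** Y) = Re_mat X ** Im_mat Y + Im_mat X ** Re_mat Y"
  by (simp add: Re_mat_def Im_mat_def matrix_matrix_mult_def vec_eq_iff sum.distrib)

lemma Re_mat_add: "Re_mat (X + Y) = Re_mat X + Re_mat Y"
  by (simp add: Re_mat_def vec_eq_iff)

lemma Re_mat_scaleR: "Re_mat (r *\<^sub>R X) = r *\<^sub>R Re_mat X"
  by (simp add: Re_mat_def vec_eq_iff)

lemma Im_mat_scaleR: "Im_mat (r *\<^sub>R X) = r *\<^sub>R Im_mat X"
  by (simp add: Im_mat_def vec_eq_iff)

lemma Re_mat_cmat [simp]: "Re_mat (cmat D) = D"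
  by (simp add: Re_mat_def cmat_def vec_eq_iff)

lemma Im_mat_cmat [simp]: "Im_mat (cmat D) = 0"
  by (simp add: Im_mat_def cmat_def vec_eq_iff)

lemma Re_mat_mat [simp]: "Re_mat (mat c) = mat (Re c)"
  by (simp add: Re_mat_def mat_def vec_eq_iff)

lemma Im_mat_mat [simp]: "Im_mat (mat c) = mat (Im c)"
  by (simp add: Im_mat_def mat_def vec_eq_iff)

lemma cmat_mult: "cmat (X ** Y) = cmat X ** cmat Y"
  by (simp add: cmat_def matrix_matrix_mult_def vec_eq_iff)

lemma cmat_add: "cmat (X + Y) = cmat X + cmat Y"
  by (simp add: cmat_def vec_eq_iff)

lemma cmat_mat_1 [simp]: "cmat (mat 1) = mat 1"
  by (simp add: cmat_def mat_def vec_eq_iff)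

lemma Re_vec_mult_cvec: "Re_vec (X *v cvec v) = Re_mat X *v v"
  by (simp add: Re_vec_def Re_mat_def cvec_def matrix_vector_mult_def vec_eq_iff)

lemma Im_vec_mult_cvec: "Im_vec (X *v cvec v) = Im_mat X *v v"
  by (simp add: Im_vec_def Im_mat_def cvec_def matrix_vector_mult_def vec_eq_iff)

lemma Re_vec_add: "Re_vec (u + v) = Re_vec u + Re_vec v"
  by (simp add: Re_vec_def vec_eq_iff)

lemma Im_vec_add: "Im_vec (u + v) = Im_vec u + Im_vec v"
  by (simp add: Im_vec_def vec_eq_iff)

section \<open>Diagonal matrices and their square roots\<close>

lemma diagonal_matrix_transpose: "diagonal_matrix D \<Longrightarrow> transpose D = D"
  unfolding diagonal_matrix_def transpose_def vec_eq_iff by (simp, metis)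

lemma diagonal_matrix_square:
  fixes D :: "real ^ 'n ^ 'n"
  assumes "diagonal_matrix D"
  shows "D ** D = (\<chi> i j. if i = j then (D $ i $ i)\<^sup>2 else 0)"
proof -
  have "(\<Sum>k\<in>UNIV. D $ i $ k * D $ k $ j) = (if i = j then (D $ i $ i)\<^sup>2 else 0)" for i j
  proof -
    have "(\<Sum>k\<in>UNIV. D $ i $ k * D $ k $ j) = (\<Sum>k\<in>UNIV. if k = i then D $ i $ i * D $ i $ j else 0)"
      using assms by (intro sum.cong) (auto simp: diagonal_matrix_def)
    then show ?thesis
      using assms by (simp add: diagonal_matrix_def power2_eq_square)
  qed
  then show ?thesis
    by (simp add: matrix_matrix_mult_def)
qed

lemma diagonal_diag_sqrt: "diagonal_matrix (diag_sqrt D)"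
  by (simp add: diagonal_matrix_def diag_sqrt_def)

lemma diag_sqrt_square:
  fixes D :: "real ^ 'n ^ 'n"
  assumes "diagonal_matrix D" "\<And>i. 0 \<le> D $ i $ i"
  shows "diag_sqrt D ** diag_sqrt D = D"
  using assms unfolding diagonal_matrix_square[OF diagonal_diag_sqrt]
  by (auto simp: diag_sqrt_def vec_eq_iff diagonal_matrix_def)

text \<open>Conjugation without transposition: for the symmetric DFT matrices this is already the
  adjoint.\<close>

definition cnj_mat :: "complex ^ 'n ^ 'm \<Rightarrow> complex ^ 'n ^ 'm" where
  "cnj_mat X = (\<chi> i j. cnj (X $ i $ j))"

lemma cnj_mat_mult: "cnj_mat (X ** Y) = cnj_mat X ** cnj_mat Y"
  by (simp add: cnj_mat_def matrix_matrix_mult_def vec_eq_iff)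

lemma cnj_mat_cnj_mat [simp]: "cnj_mat (cnj_mat X) = X"
  by (simp add: cnj_mat_def vec_eq_iff)

lemma cnj_mat_of_nat [simp]: "cnj_mat (mat (of_nat n)) = mat (of_nat n)"
  by (simp add: cnj_mat_def mat_def vec_eq_iff)

lemma Re_mat_cnj [simp]: "Re_mat (cnj_mat X) = Re_mat X"
  by (simp add: Re_mat_def cnj_mat_def vec_eq_iff)

lemma Im_mat_cnj [simp]: "Im_mat (cnj_mat X) = - Im_mat X"
  by (simp add: Im_mat_def cnj_mat_def vec_eq_iff)

section \<open>The discrete Fourier transform\<close>

lemma transpose_kronecker: "transpose (X \<otimes>\<^sub>K Y) = transpose X \<otimes>\<^sub>K transpose Y"
  by (simp add: transpose_def kronecker_def vec_eq_iff)

lemma cnj_mat_kronecker: "cnj_mat (X \<otimes>\<^sub>K Y) = cnj_mat X \<otimes>\<^sub>K cnj_mat Y"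
  by (simp add: cnj_mat_def kronecker_def vec_eq_iff)

text \<open>The mixed-product rule: a sum over pairs of indices factors into two sums. It reduces
  products of three-dimensional DFT matrices to the one-dimensional case.\<close>

lemma kronecker_mult:
  fixes A B C D :: "'a::comm_semiring_1 ^ _ ^ _"
  shows "(A \<otimes>\<^sub>K B) ** (C \<otimes>\<^sub>K D) = (A ** C) \<otimes>\<^sub>K (B ** D)"
  by (simp add: kronecker_def matrix_matrix_mult_def vec_eq_iff sum_product
      UNIV_Times_UNIV[symmetric] sum.cartesian_product split_beta mult_ac del: UNIV_Times_UNIV)

lemma kronecker_mat: "mat a \<otimes>\<^sub>K mat b = mat (a * b :: 'a::mult_zero)"
  by (auto simp: kronecker_def mat_def vec_eq_iff prod_eq_iff)

text \<open>Initial segments grow strictly, so \<open>pos\<close> is injective, and counting makes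
  it onto. This turns sums over the index type into geometric sums.\<close>

lemma bij_betw_pos: "bij_betw pos (UNIV :: 'n::{finite,linorder} set) {..<CARD('n)}"
proof -
  have "strict_mono (pos :: 'n \<Rightarrow> nat)"
    unfolding strict_mono_def pos_def by (intro allI impI psubset_card_mono) auto
  then have inj: "inj (pos :: 'n \<Rightarrow> nat)"
    by (rule strict_mono_imp_inj_on)
  moreover have "range (pos :: 'n \<Rightarrow> nat) \<subseteq> {..<CARD('n)}"
    unfolding pos_def by (auto intro!: psubset_card_mono)
  ultimately show ?thesis
    by (metis bij_betw_def card_image card_lessThan card_subset_eq finite_lessThan)
qed

section \<open>Roots of unity and their power sums\<close>

lemma dft_root_eq_cis: "dft_root n = cis (- (2 * pi / real n))"
  by (simp add: dft_root_def cis_conv_exp mult_ac)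

text \<open>The conjugate has the positive exponent used in \<open>complex_root_unity\<close> and
  \<open>complex_root_unity_eq\<close>.\<close>

lemma cnj_dft_root: "cnj (dft_root n) = exp (2 * of_real pi * \<i> / of_nat n)"
  unfolding dft_root_eq_cis cis_cnj by (simp add: cis_conv_exp mult_ac)

lemma dft_root_mult_cnj: "dft_root n * cnj (dft_root n) = 1"
  by (simp add: dft_root_eq_cis cis_cnj cis_mult)

lemma dft_root_power_card: "n \<noteq> 0 \<Longrightarrow> dft_root n ^ n = 1"
  using complex_root_unity[of n 1] dft_root_mult_cnj[of n]
  by (simp add: cnj_dft_root) (metis mult.right_neutral power_mult_distrib power_one)

lemma sum_powers_root_of_unity:
  fixes \<zeta> :: complex
  assumes "\<zeta> ^ n = 1"
  shows "(\<Sum>k<n. \<zeta> ^ k) = (if \<zeta> = 1 then of_nat n else 0)"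
  using assms by (simp add: geometric_sum)

lemma sum_powers_pos:
  fixes \<zeta> :: complex
  assumes "\<zeta> ^ CARD('n) = 1"
  shows "(\<Sum>j\<in>UNIV. \<zeta> ^ pos (j :: 'n::{finite,linorder})) = (if \<zeta> = 1 then of_nat CARD('n) else 0)"
  using sum.reindex_bij_betw[OF bij_betw_pos[where 'n = 'n], of "\<lambda>k. \<zeta> ^ k"] sum_powers_root_of_unity[OF assms]
  by simp

section \<open>The one-dimensional DFT matrix\<close>

lemma transpose_dft_matrix: "transpose dft_matrix = dft_matrix"
  by (simp add: transpose_def dft_matrix_def mult.commute)

text \<open>Orthogonality of characters: each entry is the sum of all powers of a root of unity
  \<open>\<zeta>\<close>, which vanishes unless \<open>\<zeta> = 1\<close>, that is, off the
  diagonal.\<close>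

lemma dft_matrix_mult_cnj:
  "(dft_matrix :: complex ^ 'n::{finite,linorder} ^ 'n::{finite,linorder}) ** cnj_mat dft_matrix = mat (of_nat CARD('n))"
proof -
  let ?\<omega> = "dft_root CARD('n)"
  have "(\<Sum>j\<in>UNIV. ?\<omega> ^ (pos m * pos (j :: 'n)) * cnj (?\<omega> ^ (pos j * pos k)))
      = (if m = k then of_nat CARD('n) else 0)" for m k :: 'n
  proof -
    define \<zeta> where "\<zeta> = ?\<omega> ^ pos m * cnj ?\<omega> ^ pos k"
    have "\<zeta> ^ CARD('n) = (?\<omega> ^ CARD('n)) ^ pos m * cnj (?\<omega> ^ CARD('n)) ^ pos k"
      unfolding \<zeta>_def power_mult_distrib complex_cnj_power power_mult[symmetric]
      by (simp add: mult.commute)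
    then have "\<zeta> ^ CARD('n) = 1"
      by (simp add: dft_root_power_card)
    moreover have "\<zeta> = 1 \<longleftrightarrow> m = k"
    proof -
      \<comment> \<open>Multiplying by a nonzero power of the conjugate root leaves two powers of
        that root to compare.\<close>
      have "\<zeta> = 1 \<longleftrightarrow> cnj ?\<omega> ^ pos m * \<zeta> = cnj ?\<omega> ^ pos m"
        by (simp add: cnj_dft_root)
      also have "cnj ?\<omega> ^ pos m * \<zeta> = (?\<omega> * cnj ?\<omega>) ^ pos m * cnj ?\<omega> ^ pos k"
        unfolding \<zeta>_def power_mult_distrib by (simp only: mult_ac)
      also have "\<dots> = cnj ?\<omega> ^ pos k"
        by (simp only: dft_root_mult_cnj) simp
      also have "cnj ?\<omega> ^ pos k = cnj ?\<omega> ^ pos m \<longleftrightarrow> pos k mod CARD('n) = pos m mod CARD('n)"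
        using complex_root_unity_eq[of "CARD('n)" "pos k" "pos m"]
        by (simp add: cnj_dft_root exp_of_nat_mult[symmetric] mult_ac Suc_le_eq)
      \<comment> \<open>Positions lie below \<open>CARD('n)\<close>, so congruent ones are equal,
        and \<open>pos\<close> is injective.\<close>
      also have "\<dots> \<longleftrightarrow> m = k"
      proof -
        have "pos i < CARD('n)" for i :: 'n
          using bij_betw_pos[where 'n = 'n] by (auto simp: bij_betw_def)
        then show ?thesis
          using bij_betw_pos[where 'n = 'n] by (auto simp: bij_betw_def dest: injD)
      qed
      finally show ?thesis .
    qed
    moreover have "?\<omega> ^ (pos m * pos j) * cnj (?\<omega> ^ (pos j * pos k)) = \<zeta> ^ pos j" for j :: 'n
      unfolding \<zeta>_def power_mult_distrib complex_cnj_power power_mult[symmetric]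
      by (simp add: mult.commute)
    ultimately show ?thesis
      by (simp add: sum_powers_pos)
  qed
  then show ?thesis
    by (simp add: matrix_matrix_mult_def dft_matrix_def cnj_mat_def mat_def)
qed

text \<open>Each entry sums all powers of the root of unity with exponent
  \<open>pos m + pos k\<close>, so it is the size or 0, in particular real.\<close>

lemma cnj_dft_matrix_square: "cnj_mat (dft_matrix ** dft_matrix) = dft_matrix ** dft_matrix"
proof -
  let ?\<omega> = "dft_root CARD('a)"
  have "(\<Sum>j\<in>UNIV. ?\<omega> ^ (pos m * pos (j :: 'a)) * ?\<omega> ^ (pos j * pos k)) \<in> \<real>" for m k :: 'a
  proof -
    define \<zeta> where "\<zeta> = ?\<omega> ^ (pos m + pos k)"
    have "\<zeta> ^ CARD('a) = (?\<omega> ^ CARD('a)) ^ (pos m + pos k)"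
      unfolding \<zeta>_def power_mult[symmetric] by (simp add: mult.commute)
    then have "\<zeta> ^ CARD('a) = 1"
      by (simp add: dft_root_power_card)
    moreover have "?\<omega> ^ (pos m * pos j) * ?\<omega> ^ (pos j * pos k) = \<zeta> ^ pos j" for j :: 'a
      unfolding \<zeta>_def power_mult[symmetric] power_add[symmetric] by (simp add: algebra_simps)
    ultimately show ?thesis
      by (simp add: sum_powers_pos)
  qed
  then show ?thesis
    unfolding cnj_mat_def matrix_matrix_mult_def dft_matrix_def vec_eq_iff
    by (simp only: vec_lambda_beta Reals_cnj_iff) simp
qed

section \<open>The three-dimensional DFT matrix\<close>

lemma transpose_dft3_matrix: "transpose dft3_matrix = dft3_matrix"
  by (simp add: dft3_matrix_def transpose_kronecker transpose_dft_matrix)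

lemma dft3_matrix_mult_cnj:
  "(dft3_matrix :: complex ^ _ ^ ('f::{finite,linorder} \<times> 'h::{finite,linorder} \<times> 'w::{finite,linorder}))
     ** cnj_mat dft3_matrix = mat (of_nat (CARD('f) * CARD('h) * CARD('w)))"
  by (simp add: dft3_matrix_def cnj_mat_kronecker kronecker_mult dft_matrix_mult_cnj kronecker_mat
      mult.assoc)

lemma cnj_dft3_matrix_square: "cnj_mat (dft3_matrix ** dft3_matrix) = dft3_matrix ** dft3_matrix"
  by (simp add: dft3_matrix_def cnj_mat_kronecker kronecker_mult cnj_dft_matrix_square)

lemma dft3_matrix_Re_Im:
  fixes F :: "complex ^ ('f::{finite,linorder} \<times> 'h::{finite,linorder} \<times> 'w::{finite,linorder})
                      ^ ('f \<times> 'h \<times> 'w)"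
  defines "F \<equiv> dft3_matrix"
  shows "Re_mat F ** Im_mat F = 0" "Im_mat F ** Re_mat F = 0"
    "Re_mat (matrix_inv F) = (1 / real (CARD('f) * CARD('h) * CARD('w))) *\<^sub>R Re_mat F"
    "Im_mat (matrix_inv F) = - ((1 / real (CARD('f) * CARD('h) * CARD('w))) *\<^sub>R Im_mat F)"
    "matrix_inv F ** F = mat 1" "F ** matrix_inv F = mat 1"
proof -
  define n where "n = CARD('f) * CARD('h) * CARD('w)"
  have "n \<noteq> 0"
    by (simp add: n_def)
  have FcF: "F ** cnj_mat F = mat (of_nat n)"
    unfolding F_def n_def by (rule dft3_matrix_mult_cnj)
  from arg_cong[OF this, of cnj_mat] have cFF: "cnj_mat F ** F = mat (of_nat n)"
    by (simp add: cnj_mat_mult)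
  \<comment> \<open>The imaginary part of \<open>F ** cnj_mat F\<close> is the commutator of the two
    parts up to sign, and the scalar matrix \<open>mat (of_nat n)\<close> has imaginary part
    0.\<close>
  have comm: "Re_mat F ** Im_mat F = Im_mat F ** Re_mat F"
    using arg_cong[OF FcF, of Im_mat] by (simp add: Im_mat_mult matrix_mult_minus_right)
  have "Im_mat (F ** F) = 0"
  proof -
    have "Im_mat (F ** F) = - Im_mat (F ** F)"
      using cnj_dft3_matrix_square Im_mat_cnj unfolding F_def by metis
    then show ?thesis
      by (simp add: vec_eq_iff)
  qed
  then have "Re_mat F ** Im_mat F + Im_mat F ** Re_mat F = 0"
    by (simp add: Im_mat_mult)
  \<comment> \<open>The two parts commute and anticommute, so twice their product is 0.\<close>
  with comm show "Re_mat F ** Im_mat F = 0" "Im_mat F ** Re_mat F = 0"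
    by (simp_all flip: scaleR_2)
  have scale: "(1 / real n) *\<^sub>R mat (of_nat n) = (mat 1 :: complex ^ ('f \<times> 'h \<times> 'w) ^ ('f \<times> 'h \<times> 'w))"
    using \<open>n \<noteq> 0\<close> by (simp add: mat_def vec_eq_iff complex_eq_iff)
  have inv: "F ** ((1 / real n) *\<^sub>R cnj_mat F) = mat 1" "((1 / real n) *\<^sub>R cnj_mat F) ** F = mat 1"
    by (simp_all only: matrix_mult_scaleR_left matrix_mult_scaleR_right FcF cFF scale)
  then have "matrix_inv F = (1 / real n) *\<^sub>R cnj_mat F"
    by (rule matrix_inv_eqI)
  with inv show "Re_mat (matrix_inv F) = (1 / real (CARD('f) * CARD('h) * CARD('w))) *\<^sub>R Re_mat F"
    "Im_mat (matrix_inv F) = - ((1 / real (CARD('f) * CARD('h) * CARD('w))) *\<^sub>R Im_mat F)"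
    "matrix_inv F ** F = mat 1" "F ** matrix_inv F = mat 1"
    by (simp_all add: n_def[symmetric] Re_mat_scaleR Im_mat_scaleR)
qed

section \<open>The law of z\<close>

theorem mainTheorem2:
  fixes M :: "'s measure"
    and F :: "complex ^ ('f::{finite,linorder} \<times> 'h::{finite,linorder} \<times> 'w::{finite,linorder})
                      ^ ('f \<times> 'h \<times> 'w)"
    and A B \<Lambda> Q :: "real ^ ('f \<times> 'h \<times> 'w) ^ ('f \<times> 'h \<times> 'w)"
    and f h w N :: nat
    and \<theta> :: real
    and x \<eta>1 \<eta>2 y1 y2 x1 x2 z :: "'s \<Rightarrow> real ^ ('f \<times> 'h \<times> 'w)"
    and z1 z2 :: "'s \<Rightarrow> complex ^ ('f \<times> 'h \<times> 'w)"
  assumes f: "f = CARD('f)" and h: "h = CARD('h)" and w: "w = CARD('w)"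
    and N: "N = f * h * w"
    and F: "F = dft3_matrix"
    and A: "A = Re_mat F"
    and B: "B = Im_mat F"
    and Lambda_diag: "diagonal_matrix \<Lambda>"
    and Lambda_range: "\<And>i. \<Lambda> $ i $ i \<in> {0..1}"
    and M: "prob_space M"
    and indep: "prob_space.indep_vars M (\<lambda>_. borel)
                  (\<lambda>k. [x, \<eta>1, \<eta>2, y1, y2] ! k) {..<5::nat}"
    and gaussian: "\<And>X. X \<in> {x, \<eta>1, \<eta>2, y1, y2} \<Longrightarrow> gaussian_vector M X 0 (mat 1)"
    and x1: "\<And>\<omega>. x1 \<omega> = (1 / sqrt (1 + (cos \<theta>)\<^sup>2)) *\<^sub>R (cos \<theta> *\<^sub>R x \<omega> + sin \<theta> *\<^sub>R \<eta>1 \<omega>)"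
    and x2: "\<And>\<omega>. x2 \<omega> = (1 / sqrt (1 + (cos \<theta>)\<^sup>2)) *\<^sub>R (cos \<theta> *\<^sub>R x \<omega> + sin \<theta> *\<^sub>R \<eta>2 \<omega>)"
    and z1: "\<And>\<omega>. z1 \<omega> = (matrix_inv F ** cmat \<Lambda> ** F) *v cvec (x1 \<omega>)
                   + (matrix_inv F ** cmat (diag_sqrt (mat 1 - \<Lambda> ** \<Lambda>)) ** F) *v cvec (y1 \<omega>)"
    and z2: "\<And>\<omega>. z2 \<omega> = (matrix_inv F ** cmat \<Lambda> ** F) *v cvec (x2 \<omega>)
                   + (matrix_inv F ** cmat (diag_sqrt (mat 1 - \<Lambda> ** \<Lambda>)) ** F) *v cvec (y2 \<omega>)"
    and z: "\<And>\<omega>. z \<omega> = (1 / sqrt 2) *\<^sub>R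
                   (Re_vec (z1 \<omega>) + Im_vec (z1 \<omega>) + Re_vec (z2 \<omega>) - Im_vec (z2 \<omega>))"
    and Q: "Q = (1 / real N) *\<^sub>R (A ** \<Lambda> ** B + B ** \<Lambda> ** A)"
  shows "gaussian_vector M z 0
           (mat 1 - (2 * (cos \<theta>)\<^sup>2 / (1 + (cos \<theta>)\<^sup>2)) *\<^sub>R (Q ** Q))"
proof -
  interpret prob_space M by fact

  \<comment> \<open>The matrices \<open>H D\<close>, their parts and their identities\<close>
  define S where "S = diag_sqrt (mat 1 - \<Lambda> ** \<Lambda>)"
  define G where "G = matrix_inv F"
  define c where "c = 1 / real N"
  define H where "H D = G ** cmat D ** F" for D
  \<comment> \<open>\<open>P D\<close> and \<open>R D\<close> come from expanding
    \<open>c (A - iB) D (A + iB)\<close>, the inverse of \<open>F\<close> being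
    \<open>c (A - iB)\<close>.\<close>
  define P where "P D = c *\<^sub>R (A ** D ** A + B ** D ** B)" for D
  define R where "R D = c *\<^sub>R (A ** D ** B - B ** D ** A)" for D
  have N_eq: "real N = real (CARD('f) * CARD('h) * CARD('w))"
    by (simp add: N f h w)
  note dft = dft3_matrix_Re_Im[where 'f = 'f and 'h = 'h and 'w = 'w, folded F, folded A B G_def N_eq c_def]
  have AB: "A ** B = 0" and BA: "B ** A = 0"
    by (fact dft)+
  have ReH: "Re_mat (H D) = P D" and ImH: "Im_mat (H D) = R D" for D
    unfolding H_def P_def R_def
    by (simp_all add: Re_mat_mult Im_mat_mult dft A[symmetric] B[symmetric] matrix_distribs
        matrix_mult_minus_left scaleR_add_right scaleR_diff_right)
  have sym: "transpose A = A" "transpose B = B"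
    using transpose_dft3_matrix[where 'a = 'f and 'b = 'h and 'c = 'w]
    by (auto simp: A B F Re_mat_def Im_mat_def transpose_def vec_eq_iff)
  \<comment> \<open>Transposition fixes both terms of \<open>P D\<close> and exchanges the two terms
    of \<open>R D\<close>.\<close>
  have trans: "transpose (P D) = P D" "transpose (R D) = - R D" if "transpose D = D" for D
    using that unfolding P_def R_def
    by (simp_all add: transpose_scalar transpose_add transpose_diff matrix_transpose_mul sym
        matrix_mul_assoc scaleR_diff_right)
  have L2: "\<Lambda> ** \<Lambda> = (\<chi> i j. if i = j then (\<Lambda> $ i $ i)\<^sup>2 else 0)"
    by (rule diagonal_matrix_square) fact
  have S2: "S ** S = mat 1 - \<Lambda> ** \<Lambda>"
    unfolding S_def
  proof (rule diag_sqrt_square)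
    show "diagonal_matrix (mat 1 - \<Lambda> ** \<Lambda>)"
      by (simp add: L2 diagonal_matrix_def mat_def)
    \<comment> \<open>Here the entries of \<open>\<Lambda>\<close> must lie in [0,1]; otherwise
      \<open>diag_sqrt\<close> would not be a genuine square root.\<close>
    show "0 \<le> (mat 1 - \<Lambda> ** \<Lambda>) $ i $ i" for i
      using Lambda_range[of i] by (simp add: L2 mat_def power_le_one)
  qed
  have tL: "transpose \<Lambda> = \<Lambda>" and tS: "transpose S = S"
    unfolding S_def by (intro diagonal_matrix_transpose Lambda_diag diagonal_diag_sqrt)+
  \<comment> \<open>The inner factor \<open>F ** G\<close> cancels, so \<open>H\<close> is
    multiplicative. As it is also additive, the squares of \<open>H \<Lambda>\<close> and
    \<open>H S\<close> sum to \<open>H (mat 1)\<close>.\<close>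
  have HH: "H D ** H E = H (D ** E)" for D E
  proof -
    have "H D ** H E = G ** cmat D ** (F ** G) ** cmat E ** F"
      by (simp only: H_def matrix_mul_assoc)
    then show ?thesis
      by (simp only: dft matrix_mul_rid H_def cmat_mult matrix_mul_assoc)
  qed
  have "H \<Lambda> ** H \<Lambda> + H S ** H S = H (\<Lambda> ** \<Lambda> + S ** S)"
    unfolding HH by (simp add: H_def cmat_add matrix_distribs)
  also have "\<dots> = mat 1"
    by (simp add: S2 H_def dft)
  finally have "Re_mat (H \<Lambda> ** H \<Lambda> + H S ** H S) = mat 1"
    by simp
  then have energy: "P \<Lambda> ** P \<Lambda> - R \<Lambda> ** R \<Lambda> + (P S ** P S - R S ** R S) = mat 1"
    by (simp only: Re_mat_add Re_mat_mult ReH ImH)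
  have vanish: "A ** (B ** X) = 0" "B ** (A ** X) = 0" for X :: "real ^ ('f \<times> 'h \<times> 'w) ^ ('f \<times> 'h \<times> 'w)"
    by (simp_all add: matrix_mul_assoc AB BA)
  \<comment> \<open>With \<open>U = A ** \<Lambda> ** B\<close> and
    \<open>V = B ** \<Lambda> ** A\<close>, the squares of \<open>U\<close> and \<open>V\<close>
    vanish by \<open>vanish\<close>. Only \<open>U ** V\<close> and \<open>V ** U\<close> survive,
    with sign plus in \<open>Q ** Q\<close> and minus in the square of
    \<open>R \<Lambda>\<close>.\<close>
  have QQ: "Q ** Q = - (R \<Lambda> ** R \<Lambda>)"
    unfolding Q R_def c_def[symmetric]
    by (simp add: matrix_distribs matrix_mul_assoc[symmetric] vanish scaleR_add_right scaleR_diff_right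
        algebra_simps)

  \<comment> \<open>\<open>z\<close> as a sum of images of independent Gaussian vectors\<close>
  define a where "a = 1 / sqrt (1 + (cos \<theta>)\<^sup>2)"
  have a2: "a\<^sup>2 = 1 / (1 + (cos \<theta>)\<^sup>2)"
    by (simp add: a_def power_divide add_nonneg_nonneg)
  define b where "b = 1 / sqrt 2"
  have b2: "b\<^sup>2 = 1 / 2"
    by (simp add: b_def power_divide)
  \<comment> \<open>The coefficients of \<open>x\<close>, \<open>\<eta>1\<close>,
    \<open>\<eta>2\<close>, \<open>y1\<close>, \<open>y2\<close> in \<open>z\<close>. Since
    \<open>x\<close> enters both \<open>x1\<close> and \<open>x2\<close>, its matrices
    \<open>P \<Lambda> + R \<Lambda>\<close> and \<open>P \<Lambda> - R \<Lambda>\<close> add up and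
    \<open>R \<Lambda>\<close> cancels.\<close>
  define L where "L = [(2 * b * a * cos \<theta>) *\<^sub>R P \<Lambda>, (b * a * sin \<theta>) *\<^sub>R (P \<Lambda> + R \<Lambda>),
    (b * a * sin \<theta>) *\<^sub>R (P \<Lambda> - R \<Lambda>), b *\<^sub>R (P S + R S), b *\<^sub>R (P S - R S)]"
  have "z \<omega> = (\<Sum>k<5. L ! k *v ([x, \<eta>1, \<eta>2, y1, y2] ! k) \<omega>)" for \<omega>
    unfolding z z1 z2 x1 x2 a_def[symmetric] b_def[symmetric] G_def[symmetric] S_def[symmetric]
      H_def[symmetric] Re_vec_add Im_vec_add Re_vec_mult_cvec Im_vec_mult_cvec ReH ImH
    by (simp add: L_def eval_nat_numeral matrix_vector_right_distrib matrix_vector_mult_add_rdistrib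
        matrix_vector_mult_diff_rdistrib matrix_vector_mult_scaleR scaleR_matrix_vector_assoc[symmetric]
        algebra_simps)
      (simp add: vec_eq_iff)
  then have z_eq: "z = (\<lambda>\<omega>. \<Sum>k<5. L ! k *v ([x, \<eta>1, \<eta>2, y1, y2] ! k) \<omega>)"
    by blast
  have "gaussian_vector M z (\<Sum>k<5. L ! k *v 0) (\<Sum>k<5. L ! k ** mat 1 ** transpose (L ! k))"
    unfolding z_eq
  proof (rule gaussian_vector_sum)
    show "indep_vars (\<lambda>_. borel) (\<lambda>k \<omega>. L ! k *v ([x, \<eta>1, \<eta>2, y1, y2] ! k) \<omega>) {..<5}"
      by (intro indep_vars_compose2[OF indep] borel_measurable_continuous_onI
          matrix_vector_mult_linear_continuous_on)
    show "gaussian_vector M (\<lambda>\<omega>. L ! k *v ([x, \<eta>1, \<eta>2, y1, y2] ! k) \<omega>) (L ! k *v 0)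
        (L ! k ** mat 1 ** transpose (L ! k))" if "k \<in> {..<5}" for k
    proof (rule gaussian_vector_matrix_mult[OF gaussian])
      show "[x, \<eta>1, \<eta>2, y1, y2] ! k \<in> {x, \<eta>1, \<eta>2, y1, y2}"
        using that nth_mem[of k "[x, \<eta>1, \<eta>2, y1, y2]"] by simp
    qed
  qed simp

  \<comment> \<open>The covariance\<close>
  moreover have "(\<Sum>k<5. L ! k ** mat 1 ** transpose (L ! k))
      = mat 1 - (2 * (cos \<theta>)\<^sup>2 / (1 + (cos \<theta>)\<^sup>2)) *\<^sub>R (Q ** Q)"
  proof -
    \<comment> \<open>By antisymmetry of \<open>R D\<close>, transposition exchanges
      \<open>P D + R D\<close> and \<open>P D - R D\<close>; the mixed products then cancel in the
      sum.\<close>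
    have conj: "(P D + R D) ** transpose (P D + R D) + (P D - R D) ** transpose (P D - R D)
        = 2 *\<^sub>R (P D ** P D - R D ** R D)" if "transpose D = D" for D
      using trans[OF that]
      by (simp add: transpose_add transpose_diff matrix_distribs matrix_mult_minus_right
          algebra_simps scaleR_2)
    have scale: "(k *\<^sub>R X) ** mat 1 ** transpose (k *\<^sub>R X) = k\<^sup>2 *\<^sub>R (X ** transpose X)"
      for k and X :: "real ^ ('f \<times> 'h \<times> 'w) ^ ('f \<times> 'h \<times> 'w)"
      by (simp add: matrix_distribs transpose_scalar power2_eq_square)
    define u where "u = 2 * (cos \<theta>)\<^sup>2 / (1 + (cos \<theta>)\<^sup>2)"
    have denom: "1 + (cos \<theta>)\<^sup>2 \<noteq> 0"
      by (smt (verit) zero_le_power2)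
    \<comment> \<open>The second equation uses
      \<open>1 - u = (sin \<theta>)^2 / (1 + (cos \<theta>)^2)\<close>.\<close>
    have coeffs: "(2 * b * a * cos \<theta>)\<^sup>2 = u" "(b * a * sin \<theta>)\<^sup>2 = (1 - u) / 2"
      using denom by (simp_all add: u_def power_mult_distrib a2 b2 sin_squared_eq field_simps)
    have "(\<Sum>k<5. L ! k ** mat 1 ** transpose (L ! k))
      = u *\<^sub>R (P \<Lambda> ** P \<Lambda>)
      + ((1 - u) / 2) *\<^sub>R ((P \<Lambda> + R \<Lambda>) ** transpose (P \<Lambda> + R \<Lambda>) + (P \<Lambda> - R \<Lambda>) ** transpose (P \<Lambda> - R \<Lambda>))
      + (1 / 2) *\<^sub>R ((P S + R S) ** transpose (P S + R S) + (P S - R S) ** transpose (P S - R S))"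
    proof -
      have five: "(\<Sum>k<5. g k) = g 0 + g 1 + g 2 + g 3 + g 4"
        for g :: "nat \<Rightarrow> real ^ ('f \<times> 'h \<times> 'w) ^ ('f \<times> 'h \<times> 'w)"
        by (simp add: eval_nat_numeral)
      have nth: "L ! 0 = (2 * b * a * cos \<theta>) *\<^sub>R P \<Lambda>" "L ! 1 = (b * a * sin \<theta>) *\<^sub>R (P \<Lambda> + R \<Lambda>)"
        "L ! 2 = (b * a * sin \<theta>) *\<^sub>R (P \<Lambda> - R \<Lambda>)" "L ! 3 = b *\<^sub>R (P S + R S)"
        "L ! 4 = b *\<^sub>R (P S - R S)"
        by (simp_all add: L_def)
      show ?thesis
        unfolding five nth scale coeffs b2 trans[OF tL] by (simp only: scaleR_add_right add.assoc)
    qed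
    also have "\<dots> = u *\<^sub>R (P \<Lambda> ** P \<Lambda>) + (1 - u) *\<^sub>R (P \<Lambda> ** P \<Lambda> - R \<Lambda> ** R \<Lambda>)
        + (P S ** P S - R S ** R S)"
      by (simp add: conj[OF tL] conj[OF tS])
    \<comment> \<open>The terms free of \<open>u\<close> form the left side of
      \<open>energy\<close>. In the others \<open>P \<Lambda> ** P \<Lambda>\<close> cancels,
      because the shared noise \<open>x\<close> contributes it without the square of
      \<open>R \<Lambda>\<close>.\<close>
    also have "\<dots> = mat 1 + u *\<^sub>R (R \<Lambda> ** R \<Lambda>)"
      unfolding energy[symmetric] by (simp add: algebra_simps)
    also have "\<dots> = mat 1 - u *\<^sub>R (Q ** Q)"
      by (simp add: QQ)
    finally show ?thesis
      unfolding u_def .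
  qed
  ultimately show ?thesis
    by simp
qed

end
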